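(* Let $\mathcal{H}=(V,\mathcal{E})$ and $\mathcal{H}'=(V',\mathcal{E}')$ be two hypergraphs with $V=\{1,\dots,n\}$ and $V'=\{1,\dots,m\}$. Then $\mathcal{H}\preceq\mathcal{H}'$ if and only if $f_{\mathcal{H}}\le f_{\mathcal{H}'}$.
   Context: A hypergraph is a pair $\mathcal{H}=(V,\mathcal{E})$ with $V$ a finite nonempty set and $\mathcal{E}$ a set of subsets of $V$ (the empty set is allowed as a hyperedge). A map $h':V'\to V$ is a quotient map from $\mathcal{H}'=(V',\mathcal{E}')$ to $\mathcal{H}=(V,\mathcal{E})$ if for every $E\subseteq V$: $E\in\mathcal{E}$ if and only if the number of $E'\in\mathcal{E}'$ with $h'(E')=E$ (image set) is odd. $\mathcal{H}\preceq\mathcal{H}'$ means there is a quotient map from $\mathcal{H}'$ to $\mathcal{H}$. For a hypergraph $\mathcal{H}=(V,\mathcal{E})$ with $V=\{1,\dots,n\}$, $f_{\mathcal{H}}:\{0,1\}^n\to\{0,1\}$ is the Boolean function given by evaluating over $GF(2)=\{0,1\}$ the polynomial $P_{\mathcal{H}}=\sum_{E\in\mathcal{E}}\prod_{i\in E}x_i$. For Boolean functions $g:\{0,1\}^n\to\{0,1\}$ and $f:\{0,1\}^m\to\{0,1\}$, $g\le f$ ($g$ is a simple minor of $f$) means that there is a map $\sigma:\{1,\dots,m\}\to\{1,\dots,n\}$ with $g(x_1,\dots,x_n)=f(x_{\sigma(1)},\dots,x_{\sigma(m)})$. *)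

theory Defs
  imports "HOL-Library.FuncSet" "HOL-Library.Z2"
begin

type_synonym 'a hypergraph = "'a set \<times> 'a set set"

definition hypergraph :: "'a hypergraph \<Rightarrow> bool" where
  "hypergraph H \<longleftrightarrow>
     (case H of (V, \<E>) \<Rightarrow> finite V \<and> V \<noteq> {} \<and> \<E> \<subseteq> Pow V)"

definition hg_quotient_map ::
  "('b \<Rightarrow> 'a) \<Rightarrow> 'b hypergraph \<Rightarrow> 'a hypergraph \<Rightarrow> bool" where
  "hg_quotient_map h H' H \<longleftrightarrow>
     (case H' of (V', \<E>') \<Rightarrow> case H of (V, \<E>) \<Rightarrow>
        h \<in> V' \<rightarrow> V \<and>
        (\<forall>E. E \<subseteq> V \<longrightarrow> (E \<in> \<E> \<longleftrightarrow> odd (card {E' \<in> \<E>'. h ` E' = E}))))"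

definition hg_quotient :: "'a hypergraph \<Rightarrow> 'b hypergraph \<Rightarrow> bool"  (infix \<open>\<preceq>\<^sub>h\<close> 50) where
  "H \<preceq>\<^sub>h H' \<longleftrightarrow> (\<exists>h. hg_quotient_map h H' H)"

text \<open>
  A point of the cube of dimension \<open>n\<close> is an extensional function on \<open>{1..n}\<close> with values in
  the two-element field \<^typ>\<open>bit\<close>. A Boolean function of arity \<open>n\<close> is in turn an extensional
  function on the cube.
\<close>

definition cube :: "nat \<Rightarrow> (nat \<Rightarrow> bit) set" where
  "cube n = {1..n} \<rightarrow>\<^sub>E UNIV"

definition boolean_functions :: "nat \<Rightarrow> ((nat \<Rightarrow> bit) \<Rightarrow> bit) set" where
  "boolean_functions n = cube n \<rightarrow>\<^sub>E UNIV"

text \<open>The function \<open>f\<^sub>H\<close>, for \<open>H\<close> with vertex set \<open>{1..n}\<close>; the arithmetic is that of GF(2).\<close>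

definition hg_fun :: "nat \<Rightarrow> nat hypergraph \<Rightarrow> (nat \<Rightarrow> bit) \<Rightarrow> bit" where
  "hg_fun n H = (\<lambda>x\<in>cube n. \<Sum>E\<in>snd H. \<Prod>i\<in>E. x i)"

lemma hg_fun_boolean: "hg_fun n H \<in> boolean_functions n"
  by (simp add: hg_fun_def boolean_functions_def)

text \<open>\<open>simple_minor n g m f\<close>: the \<open>n\<close>-ary function \<open>g\<close> is a simple minor of the \<open>m\<close>-ary function \<open>f\<close>.\<close>

definition simple_minor ::
  "nat \<Rightarrow> ((nat \<Rightarrow> bit) \<Rightarrow> bit) \<Rightarrow> nat \<Rightarrow> ((nat \<Rightarrow> bit) \<Rightarrow> bit) \<Rightarrow> bool" where
  "simple_minor n g m f \<longleftrightarrow>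
     (\<exists>\<sigma> \<in> {1..m} \<rightarrow> {1..n}. \<forall>x \<in> cube n. g x = f (\<lambda>i\<in>{1..m}. x (\<sigma> i)))"

end

theory Submission
  imports Defs
begin

text \<open>
  Substituting \<open>x \<circ> \<sigma>\<close> into the polynomial of \<open>(V', \<E>')\<close> turns each monomial \<open>E'\<close> into \<open>\<sigma> ` E'\<close>,
  because \<open>x\<^sup>2 = x\<close> in GF(2). Hence the coefficient of \<open>E\<close> in the new multilinear polynomial is
  the parity of the number of \<open>E' \<in> \<E>'\<close> with \<open>\<sigma> ` E' = E\<close>. As a Boolean function has a unique
  multilinear representation over GF(2), \<open>\<sigma>\<close> witnesses the minor relation iff it is a quotient map.
\<close>

lemma prod_bit_eq_of_bool:
  fixes f :: "'a \<Rightarrow> bit"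
  assumes "finite A"
  shows "prod f A = of_bool (\<forall>i\<in>A. f i = 1)"
  using assms by (induction A rule: finite_induct) auto

text \<open>A product of bits is 1 exactly when every factor is 1, so the factors that repeat when
  \<open>h\<close> identifies elements of \<open>A\<close> collapse into one.\<close>

lemma prod_bit_image:
  fixes x :: "'b \<Rightarrow> bit"
  assumes "finite A"
  shows "(\<Prod>i\<in>A. x (h i)) = (\<Prod>j\<in>h ` A. x j)"
  using assms by (simp add: prod_bit_eq_of_bool)

lemma of_nat_bit_eq_of_bool: "(of_nat k :: bit) = of_bool (odd k)"
  by (induction k) auto

text \<open>Induction on \<open>E\<close> along proper inclusion: evaluation at the indicator vector
  of \<open>E\<close> leaves the sum of the coefficients of all subsets of \<open>E\<close>. The
  proper subsets already have equal coefficients on both sides, so they cancel and the coefficients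
  of \<open>E\<close> remain.\<close>

lemma multilinear_bit_coeff_unique:
  fixes a b :: "'a set \<Rightarrow> bit"
  assumes V: "finite V" and E: "E \<subseteq> V"
    and eq: "\<And>x. x \<in> V \<rightarrow>\<^sub>E UNIV \<Longrightarrow>
      (\<Sum>S\<in>Pow V. a S * (\<Prod>i\<in>S. x i)) = (\<Sum>S\<in>Pow V. b S * (\<Prod>i\<in>S. x i))"
  shows "a E = b E"
proof -
  have "finite E"
    using E V by (rule finite_subset)
  then show ?thesis
    using E
  proof (induction E rule: finite_psubset_induct)
    case (psubset E)
    \<comment> \<open>At this point a monomial \<open>S\<close> has value 1 if \<open>S\<close> is
      contained in \<open>E\<close>, and 0 otherwise.\<close>
    define x :: "'a \<Rightarrow> bit" where "x = (\<lambda>i\<in>V. of_bool (i \<in> E))"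
    have eval: "(\<Sum>S\<in>Pow V. c S * (\<Prod>i\<in>S. x i)) = c E + (\<Sum>S\<in>Pow E - {E}. c S)"
      for c :: "'a set \<Rightarrow> bit"
    proof -
      have "(\<Prod>i\<in>S. x i) = of_bool (S \<subseteq> E)" if "S \<subseteq> V" for S
        using that finite_subset[OF that V] by (auto simp: prod_bit_eq_of_bool x_def)
      then have "(\<Sum>S\<in>Pow V. c S * (\<Prod>i\<in>S. x i)) = (\<Sum>S\<in>Pow V. if S \<in> Pow E then c S else 0)"
        by (intro sum.cong) auto
      also have "\<dots> = (\<Sum>S\<in>Pow V \<inter> Pow E. c S)"
        using V by (simp add: sum.inter_restrict)
      also have "Pow V \<inter> Pow E = Pow E"
        using psubset.prems by auto
      also have "(\<Sum>S\<in>Pow E. c S) = c E + (\<Sum>S\<in>Pow E - {E}. c S)"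
        using psubset.hyps by (intro sum.remove) auto
      finally show ?thesis .
    qed
    have "x \<in> V \<rightarrow>\<^sub>E UNIV"
      by (simp add: x_def)
    from eq[OF this] have "a E + (\<Sum>S\<in>Pow E - {E}. a S) = b E + (\<Sum>S\<in>Pow E - {E}. b S)"
      by (simp only: eval)
    moreover have "(\<Sum>S\<in>Pow E - {E}. a S) = (\<Sum>S\<in>Pow E - {E}. b S)"
      using psubset.prems by (intro sum.cong refl psubset.IH) auto
    ultimately show ?case
      by (simp only: add_right_cancel)
  qed
qed

text \<open>Writing the edge set as 0/1 coefficients on all of \<open>Pow {1..n}\<close> gives the
  shape in which coefficients can be compared.\<close>

lemma hg_fun_eq_sum_Pow:
  assumes "\<E> \<subseteq> Pow {1..n}" and "x \<in> cube n"
  shows "hg_fun n (V, \<E>) x = (\<Sum>E\<in>Pow {1..n}. of_bool (E \<in> \<E>) * (\<Prod>i\<in>E. x i))"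
proof -
  have "(\<Sum>E\<in>Pow {1..n}. of_bool (E \<in> \<E>) * (\<Prod>i\<in>E. x i)) =
      (\<Sum>E\<in>Pow {1..n}. if E \<in> \<E> then \<Prod>i\<in>E. x i else 0)"
    by (intro sum.cong) auto
  also have "\<dots> = (\<Sum>E\<in>Pow {1..n} \<inter> \<E>. \<Prod>i\<in>E. x i)"
    by (simp add: sum.inter_restrict)
  also have "Pow {1..n} \<inter> \<E> = \<E>"
    using assms(1) by auto
  finally show ?thesis
    using assms(2) by (simp add: hg_fun_def)
qed

text \<open>Edges are grouped by their image under \<sigma>. The edges with image \<open>E\<close>
  all become the same monomial, and over GF(2) only the parity of their number survives as its
  coefficient.\<close>

lemma hg_fun_substitution:
  fixes \<sigma> :: "nat \<Rightarrow> nat"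
  assumes \<E>: "\<E> \<subseteq> Pow {1..m}" and \<sigma>: "\<sigma> \<in> {1..m} \<rightarrow> {1..n}"
  shows "hg_fun m (V, \<E>) (\<lambda>i\<in>{1..m}. x (\<sigma> i)) =
    (\<Sum>E\<in>Pow {1..n}. of_bool (odd (card {E' \<in> \<E>. \<sigma> ` E' = E})) * (\<Prod>i\<in>E. x i))"
proof -
  have fin: "finite \<E>"
    using \<E> by (rule finite_subset) simp
  have "hg_fun m (V, \<E>) (\<lambda>i\<in>{1..m}. x (\<sigma> i)) = (\<Sum>E'\<in>\<E>. \<Prod>i\<in>E'. x (\<sigma> i))"
    using \<E> by (simp add: hg_fun_def cube_def) (intro sum.cong prod.cong; force)
  also have "\<dots> = (\<Sum>E'\<in>\<E>. \<Prod>j\<in>\<sigma> ` E'. x j)"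
    using \<E> by (intro sum.cong refl prod_bit_image) (auto intro: finite_subset)
  also have "\<dots> = (\<Sum>E\<in>Pow {1..n}. \<Sum>E' | E' \<in> \<E> \<and> \<sigma> ` E' = E. \<Prod>j\<in>\<sigma> ` E'. x j)"
    using \<E> \<sigma> by (intro sum.group[symmetric] fin) auto
  also have "\<dots> = (\<Sum>E\<in>Pow {1..n}. of_nat (card {E' \<in> \<E>. \<sigma> ` E' = E}) * (\<Prod>i\<in>E. x i))"
    by (intro sum.cong) auto
  finally show ?thesis
    by (simp only: of_nat_bit_eq_of_bool)
qed

theorem theorem10:
  fixes n m :: nat
    and V V' :: "nat set"
    and \<E> \<E>' :: "nat set set"
  assumes "hypergraph (V, \<E>)" and "hypergraph (V', \<E>')"
    and "V = {1..n}" and "V' = {1..m}"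
  shows "(V, \<E>) \<preceq>\<^sub>h (V', \<E>') \<longleftrightarrow>
    simple_minor n (hg_fun n (V, \<E>)) m (hg_fun m (V', \<E>'))"
proof -
  have \<E>: "\<E> \<subseteq> Pow {1..n}" and \<E>': "\<E>' \<subseteq> Pow {1..m}"
    using assms by (auto simp: hypergraph_def)
  \<comment> \<open>The equivalence is proved for each fixed \<sigma>, so the same map serves as
    witness in both directions.\<close>
  have "(\<forall>E\<subseteq>{1..n}. E \<in> \<E> \<longleftrightarrow> odd (card {E' \<in> \<E>'. \<sigma> ` E' = E})) \<longleftrightarrow>
      (\<forall>x\<in>cube n. hg_fun n (V, \<E>) x = hg_fun m (V', \<E>') (\<lambda>i\<in>{1..m}. x (\<sigma> i)))"
    (is "?quotient \<longleftrightarrow> ?minor") if \<sigma>: "\<sigma> \<in> {1..m} \<rightarrow> {1..n}" for \<sigma>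
  proof
    assume ?quotient
    then show ?minor
      by (intro ballI, simp only: hg_fun_eq_sum_Pow[OF \<E>] hg_fun_substitution[OF \<E>' \<sigma>])
        (intro sum.cong; simp)
  next
    assume minor: ?minor
    show ?quotient
    proof (intro allI impI)
      fix E assume "E \<subseteq> {1..n}"
      then have "(of_bool (E \<in> \<E>) :: bit) = of_bool (odd (card {E' \<in> \<E>'. \<sigma> ` E' = E}))"
      \<comment> \<open>The coefficients compared are edge membership in \<E> and fibre parity, both
        as functions of a vertex set.\<close>
      proof (rule multilinear_bit_coeff_unique[rotated])
        fix x :: "nat \<Rightarrow> bit" assume "x \<in> {1..n} \<rightarrow>\<^sub>E UNIV"
        then have x: "x \<in> cube n"
          by (simp add: cube_def)
        from bspec[OF minor this] show "(\<Sum>S\<in>Pow {1..n}. of_bool (S \<in> \<E>) * (\<Prod>i\<in>S. x i)) =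
            (\<Sum>S\<in>Pow {1..n}. of_bool (odd (card {E' \<in> \<E>'. \<sigma> ` E' = S})) * (\<Prod>i\<in>S. x i))"
          by (simp only: hg_fun_eq_sum_Pow[OF \<E>] x hg_fun_substitution[OF \<E>' \<sigma>])
      qed simp
      then show "E \<in> \<E> \<longleftrightarrow> odd (card {E' \<in> \<E>'. \<sigma> ` E' = E})"
        by (simp only: of_bool_eq_iff)
    qed
  qed
  then show ?thesis
    using assms(3,4) by (auto simp: hg_quotient_def hg_quotient_map_def simple_minor_def)
qed

end
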